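(* Let $\varepsilon$ be a valid E-capacity kernel for a hypothesis class $\mathcal{H}$ on $\mathcal{P}$. Suppose that the map $P\mapsto L_P$ is $\mathcal{H}$-order-measurable. Then, for every $\ell\in\mathcal{L}$ and every $P\in H_\ell$, $$\mathbb{E}^P\left[\sup_{d\in\mathcal{D}}\varepsilon(H_{d,\ell(d)}\mid X)\right]\le 1,$$ where it is assumed that the map $x\mapsto\sup_{d\in\mathcal{D}}\varepsilon(H_{d,\ell(d)}\mid x)$ is $\Sigma$-measurable.
   Context: $(\mathcal{X},\Sigma)$ is a measurable space and $\mathcal{P}$ a collection of probability measures on it. A hypothesis class on a set is a collection of subsets closed under arbitrary unions (including the empty union, so it contains $\emptyset$). An E-capacity for $\mathcal{H}$ is a map $\varepsilon:\mathcal{H}\to[0,\infty]$ with $\varepsilon(\emptyset)=\infty$ and $\varepsilon(H')\le\varepsilon(H)$ whenever $H\subseteq H'$, $H,H'\in\mathcal{H}$. An E-capacity kernel is a map $\varepsilon:\mathcal{H}\times\mathcal{X}\to[0,\infty]$, written $\varepsilon(H\mid x)$, with $x\mapsto\varepsilon(H\mid x)$ $\Sigma$-measurable for every $H\in\mathcal{H}$ and $H\mapsto\varepsilon(H\mid x)$ an E-capacity for every $x$. It is valid if $\mathbb{E}^P[\varepsilon(H\mid X)]\le1$ for every nonempty $H\in\mathcal{H}$ and every $P\in H$, where $\mathbb{E}^P$ is expectation when $X$ has law $P$. Decision setting: $\mathcal{D}$ is a set of decisions and $\mathcal{C}$ a set of consequences equipped with a preorder $\succsim$. For each $P\in\mathcal{P}$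 there is a consequence function $L_P:\mathcal{D}\to\mathcal{C}$, and $\mathcal{L}=\{L_P:P\in\mathcal{P}\}$. For $d\in\mathcal{D}$, $c\in\mathcal{C}$ and $\ell\in\mathcal{L}$ put $$H_{d,c}=\{P\in\mathcal{P}:L_P(d)\succsim c\},\qquad H_\ell=\{P'\in\mathcal{P}:L_{P'}(d)\succsim\ell(d)\text{ for every }d\in\mathcal{D}\}.$$ Define the preorder $\ell\succsim_{\mathcal{L}}\ell'$ on $\mathcal{L}$ by $\ell(d)\succsim\ell'(d)$ for every $d\in\mathcal{D}$, and let $\mathcal{H}_{\succsim_{\mathcal{L}}}$ be the smallest union-closed collection of subsets of $\mathcal{L}$ containing all $U_\ell=\{\ell'\in\mathcal{L}:\ell'\succsim_{\mathcal{L}}\ell\}$, $\ell\in\mathcal{L}$. The map $P\mapsto L_P$ is $\mathcal{H}$-order-measurable if $\{P\in\mathcal{P}:L_P\in A\}\in\mathcal{H}$ for every $A\in\mathcal{H}_{\succsim_{\mathcal{L}}}$. (Under this assumption all $H_{d,c}$ and $H_\ell$ belong to $\mathcal{H}$.) The paper also writes $\varepsilon(L_{P^*}(d)\succsim\ell(d)\mid x)$ for $\varepsilon(H_{d,\ell(d)}\mid x)$. *)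

theory Defs
  imports "HOL-Probability.Probability"
begin

definition hypothesis_class :: "'a set \<Rightarrow> 'a set set \<Rightarrow> bool" where
  "hypothesis_class S \<H> \<longleftrightarrow> \<H> \<subseteq> Pow S \<and> (\<forall>\<A>\<subseteq>\<H>. \<Union>\<A> \<in> \<H>)"

definition e_capacity :: "'a set set \<Rightarrow> ('a set \<Rightarrow> ennreal) \<Rightarrow> bool" where
  "e_capacity \<H> \<epsilon> \<longleftrightarrow> \<epsilon> {} = \<infinity> \<and> (\<forall>H\<in>\<H>. \<forall>H'\<in>\<H>. H \<subseteq> H' \<longrightarrow> \<epsilon> H' \<le> \<epsilon> H)"

(* Only the measurable space underlying M is used. *)
definition e_capacity_kernel ::
    "'x measure \<Rightarrow> 'a set set \<Rightarrow> ('a set \<Rightarrow> 'x \<Rightarrow> ennreal) \<Rightarrow> bool" where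
  "e_capacity_kernel M \<H> \<epsilon> \<longleftrightarrow>
     (\<forall>H\<in>\<H>. \<epsilon> H \<in> borel_measurable M) \<and>
     (\<forall>x\<in>space M. e_capacity \<H> (\<lambda>H. \<epsilon> H x))"

definition valid_kernel ::
    "'x measure set set \<Rightarrow> ('x measure set \<Rightarrow> 'x \<Rightarrow> ennreal) \<Rightarrow> bool" where
  "valid_kernel \<H> \<epsilon> \<longleftrightarrow>
     (\<forall>H\<in>\<H>. H \<noteq> {} \<longrightarrow> (\<forall>P\<in>H. (\<integral>\<^sup>+ x. \<epsilon> H x \<partial>P) \<le> 1))"

(* Throughout, a preorder r is a set of pairs, and (a, b) \<in> r is read as
   "a is at least as good as b". *)

definition hyp_dc ::
    "'p set \<Rightarrow> 'c rel \<Rightarrow> ('p \<Rightarrow> 'd \<Rightarrow> 'c) \<Rightarrow> 'd \<Rightarrow> 'c \<Rightarrow> 'p set" where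
  "hyp_dc \<P> r L d c = {P \<in> \<P>. (L P d, c) \<in> r}"

definition hyp_fun ::
    "'p set \<Rightarrow> 'd set \<Rightarrow> 'c rel \<Rightarrow> ('p \<Rightarrow> 'd \<Rightarrow> 'c) \<Rightarrow> ('d \<Rightarrow> 'c) \<Rightarrow> 'p set" where
  "hyp_fun \<P> D r L l = {P' \<in> \<P>. \<forall>d\<in>D. (L P' d, l d) \<in> r}"

definition pointwise_preorder ::
    "('d \<Rightarrow> 'c) set \<Rightarrow> 'd set \<Rightarrow> 'c rel \<Rightarrow> ('d \<Rightarrow> 'c) rel" where
  "pointwise_preorder F D r = {(l, l'). l \<in> F \<and> l' \<in> F \<and> (\<forall>d\<in>D. (l d, l' d) \<in> r)}"

(* "S hull s" is the intersection of all supersets of s that satisfy S. *)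
definition order_hypotheses :: "'a set \<Rightarrow> 'a rel \<Rightarrow> 'a set set" where
  "order_hypotheses S R = hypothesis_class S hull {{a' \<in> S. (a', a) \<in> R} | a. a \<in> S}"

definition order_measurable ::
    "'p set \<Rightarrow> 'p set set \<Rightarrow> 'a set \<Rightarrow> 'a rel \<Rightarrow> ('p \<Rightarrow> 'a) \<Rightarrow> bool" where
  "order_measurable \<P> \<H> S R f \<longleftrightarrow> (\<forall>A\<in>order_hypotheses S R. {P \<in> \<P>. f P \<in> A} \<in> \<H>)"

end

theory Submission
  imports Defs
begin

text \<open>
  Since \<open>l d\<close> is the consequence threshold in every decision \<open>d\<close>, each \<open>H\<^bsub>d,l(d)\<^esub>\<close> contains \<open>H\<^sub>l\<close>.
  An E-capacity is antitone, so the supremum over \<open>d\<close> is at most \<open>\<epsilon>(H\<^sub>l | x)\<close>, and validity at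
  \<open>H\<^sub>l\<close> gives the bound.  Antitonicity is only available inside \<open>\<H>\<close>, so both sets must be seen
  to be preimages of order hypotheses: \<open>H\<^sub>l\<close> of the upper set \<open>U\<^sub>l\<close>, and \<open>H\<^bsub>d,c\<^esub>\<close> of the union of
  all \<open>U\<^bsub>l'\<^esub>\<close> with \<open>l'(d)\<close> at least as good as \<open>c\<close>.
\<close>

lemma upper_set_in_order_hypotheses:
  "a \<in> S \<Longrightarrow> {a' \<in> S. (a', a) \<in> R} \<in> order_hypotheses S R"
  unfolding order_hypotheses_def by (rule hull_inc) blast

text \<open>The hull is the intersection of all hypothesis classes containing the generators. Each
  such class contains all members of \<open>\<A>\<close>, hence also their union.\<close>

lemma Union_in_order_hypotheses:
  assumes "\<A> \<subseteq> order_hypotheses S R"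
  shows "\<Union>\<A> \<in> order_hypotheses S R"
  unfolding order_hypotheses_def hull_def
proof (rule InterI)
  fix \<T> assume "\<T> \<in> {\<T>. hypothesis_class S \<T> \<and> {{a' \<in> S. (a', a) \<in> R} | a. a \<in> S} \<subseteq> \<T>}"
  then have "hypothesis_class S \<T>" and "order_hypotheses S R \<subseteq> \<T>"
    unfolding order_hypotheses_def by (auto intro: hull_minimal[THEN subsetD])
  then show "\<Union>\<A> \<in> \<T>"
    using assms unfolding hypothesis_class_def by blast
qed

lemma order_measurableD:
  assumes "order_measurable \<P> \<H> S R f" and "A \<in> order_hypotheses S R"
  shows "{P \<in> \<P>. f P \<in> A} \<in> \<H>"
  using assms unfolding order_measurable_def by (rule bspec)

lemma hyp_fun_measurable:
  assumes "order_measurable \<P> \<H> (L ` \<P>) (pointwise_preorder (L ` \<P>) D r) L"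
    and "l \<in> L ` \<P>"
  shows "hyp_fun \<P> D r L l \<in> \<H>"
proof -
  have "hyp_fun \<P> D r L l =
      {P \<in> \<P>. L P \<in> {l' \<in> L ` \<P>. (l', l) \<in> pointwise_preorder (L ` \<P>) D r}}"
    using assms(2) by (auto simp: hyp_fun_def pointwise_preorder_def)
  also have "\<dots> \<in> \<H>"
    using assms(1) upper_set_in_order_hypotheses[OF assms(2)] by (rule order_measurableD)
  finally show ?thesis .
qed

lemma hyp_dc_measurable:
  assumes "order_measurable \<P> \<H> (L ` \<P>) (pointwise_preorder (L ` \<P>) D r) L"
    and "preorder_on C r" and "\<And>P d. P \<in> \<P> \<Longrightarrow> d \<in> D \<Longrightarrow> L P d \<in> C" and "d \<in> D"
  shows "hyp_dc \<P> r L d c \<in> \<H>"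
proof -
  let ?R = "pointwise_preorder (L ` \<P>) D r"
  let ?\<A> = "{{a \<in> L ` \<P>. (a, l) \<in> ?R} | l. l \<in> L ` \<P> \<and> (l d, c) \<in> r}"
  \<comment> \<open>\<open>preorder_on C r\<close> gives reflexivity on \<open>C\<close>, which is
    where the third assumption places the values \<open>L P d\<close>.\<close>
  have refl: "(L P, L P) \<in> ?R" if "P \<in> \<P>" for P
    using assms(2,3) that
    by (auto simp: pointwise_preorder_def preorder_on_def refl_on_def)
  \<comment> \<open>Transitivity through \<open>l d\<close>: passing to the upper set of
    \<open>l\<close> keeps the consequence in \<open>d\<close> at least as good as
    \<open>c\<close>.\<close>
  have upward: "(a d, c) \<in> r" if "(a, l) \<in> ?R" "(l d, c) \<in> r" for a l
  proof -
    have "(a d, l d) \<in> r"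
      using that(1) assms(4) by (simp add: pointwise_preorder_def)
    with that(2) show ?thesis
      using assms(2) by (meson preorder_on_def transD)
  qed
  have "hyp_dc \<P> r L d c = {P \<in> \<P>. L P \<in> \<Union>?\<A>}"
  proof (intro equalityI subsetI)
    fix P assume "P \<in> hyp_dc \<P> r L d c"
    then have "P \<in> \<P>" "(L P d, c) \<in> r"
      by (simp_all add: hyp_dc_def)
    \<comment> \<open>The index is \<open>l = L P\<close>: by reflexivity \<open>L P\<close> lies in
      its own upper set.\<close>
    then show "P \<in> {P \<in> \<P>. L P \<in> \<Union>?\<A>}"
      using refl by blast
  next
    fix P assume "P \<in> {P \<in> \<P>. L P \<in> \<Union>?\<A>}"
    then obtain l where "P \<in> \<P>" "(L P, l) \<in> ?R" "(l d, c) \<in> r"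
      by blast
    then show "P \<in> hyp_dc \<P> r L d c"
      using upward by (simp add: hyp_dc_def)
  qed
  also have "\<dots> \<in> \<H>"
    using assms(1)
  proof (rule order_measurableD)
    show "\<Union>?\<A> \<in> order_hypotheses (L ` \<P>) ?R"
      by (rule Union_in_order_hypotheses) (auto intro!: upper_set_in_order_hypotheses)
  qed
  finally show ?thesis .
qed

theorem theorem4:
  fixes M :: "'x measure"
    and \<P> :: "'x measure set"
    and \<H> :: "'x measure set set"
    and \<epsilon> :: "'x measure set \<Rightarrow> 'x \<Rightarrow> ennreal"
    and D :: "'d set"
    and C :: "'c set"
    and r :: "'c rel"
    and L :: "'x measure \<Rightarrow> 'd \<Rightarrow> 'c"
    and l :: "'d \<Rightarrow> 'c"
    and P :: "'x measure"
  assumes "\<P> \<subseteq> space (prob_algebra M)"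
    and "hypothesis_class \<P> \<H>"
    and "e_capacity_kernel M \<H> \<epsilon>"
    and "valid_kernel \<H> \<epsilon>"
    and "preorder_on C r"
    and "L \<in> \<P> \<rightarrow> (D \<rightarrow>\<^sub>E C)"
    and "order_measurable \<P> \<H> (L ` \<P>) (pointwise_preorder (L ` \<P>) D r) L"
    and "l \<in> L ` \<P>"
    and "P \<in> hyp_fun \<P> D r L l"
    and "(\<lambda>x. SUP d\<in>D. \<epsilon> (hyp_dc \<P> r L d (l d)) x) \<in> borel_measurable M"
  shows "(\<integral>\<^sup>+ x. (SUP d\<in>D. \<epsilon> (hyp_dc \<P> r L d (l d)) x) \<partial>P) \<le> 1"
proof -
  let ?H = "hyp_fun \<P> D r L l"
  have H: "?H \<in> \<H>"
    using assms(7,8) by (rule hyp_fun_measurable)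
  have "P \<in> \<P>"
    using assms(9) by (simp add: hyp_fun_def)
  \<comment> \<open>Antitonicity of the kernel holds at points of \<open>space M\<close>, while the
    integrals below run over \<open>space P\<close>.\<close>
  then have space: "space P = space M"
    using assms(1) by (auto simp: space_prob_algebra dest: sets_eq_imp_space_eq)
  have le: "(SUP d\<in>D. \<epsilon> (hyp_dc \<P> r L d (l d)) x) \<le> \<epsilon> ?H x" if "x \<in> space M" for x
  proof (rule SUP_least)
    fix d assume d: "d \<in> D"
    have "L P d \<in> C" if "P \<in> \<P>" "d \<in> D" for P d
      using assms(6) that by (auto simp: Pi_iff PiE_iff)
    then have "hyp_dc \<P> r L d (l d) \<in> \<H>"
      using hyp_dc_measurable[OF assms(7,5) _ d] by blast
    moreover have "?H \<subseteq> hyp_dc \<P> r L d (l d)"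
      using d by (auto simp: hyp_fun_def hyp_dc_def)
    ultimately show "\<epsilon> (hyp_dc \<P> r L d (l d)) x \<le> \<epsilon> ?H x"
      using assms(3) H \<open>x \<in> space M\<close>
      by (simp add: e_capacity_kernel_def e_capacity_def)
  qed
  have "(\<integral>\<^sup>+ x. (SUP d\<in>D. \<epsilon> (hyp_dc \<P> r L d (l d)) x) \<partial>P) \<le> (\<integral>\<^sup>+ x. \<epsilon> ?H x \<partial>P)"
    by (rule nn_integral_mono) (simp add: le space)
  \<comment> \<open>\<open>P\<close> itself witnesses that \<open>?H\<close> is nonempty, so
    validity applies to \<open>?H\<close> at \<open>P\<close>.\<close>
  also have "\<dots> \<le> 1"
    using assms(4,9) H by (auto simp: valid_kernel_def)
  finally show ?thesis .
qed

end
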